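(* Let $\alpha\in(0,1)$, $\sigma=1-\alpha/2$, $T>0$; let $\lambda\in\mathcal{C}^2[0,T]$ with $\lambda(t)>0$, $\lambda'(t)\le0$ on $[0,T]$; let $k,q$ be functions on $[0,1]\times[0,T]$ with $0<c_1\le k(x,t)\le c_2$ and $q(x,t)\ge0$. Suppose $u\in\mathcal{C}^{4,3}_{x,t}$ on $[0,1]\times[0,T]$ is a solution of $$\partial_{0t}^{\alpha,\lambda(t)}u=\frac{\partial}{\partial x}\left(k(x,t)\frac{\partial u}{\partial x}\right)-q(x,t)u+f(x,t),\quad 0<x<1,\ 0<t\le T,$$ $$u(0,t)=u(1,t)=0\ (0\le t\le T),\qquad u(x,0)=u_0(x)\ (0\le x\le1),$$ and that the data are such that the difference scheme $$\Delta_{0t_{j+\sigma}}^{\alpha,\lambda(t)}y_i=\Lambda y_i^{(\sigma)}+\varphi_i^{j+\sigma},\quad i=1,\dots,N-1,\ j=0,\dots,M-1,$$ $$y_0^j=y_N^j=0\ (0\le j\le M),\qquad y_i^0=u_0(x_i)\ (0\le i\le N),$$ on the grid $x_i=ih$, $h=1/N$, $t_j=j\tau$, $\tau=T/M$ (notation in the context), has approximation order $\mathcal{O}(h^2+\tau^2)$ on $u$. Then the solution of the difference scheme converges to $u$ in the grid $L_2$-norm with rate $\mathcal{O}(h^2+\tau^2)$: there is a constant $C$ independent of $h$ and $\tau$ such that $$\|u(\cdot,t_j)-y^j\|_0\le C(h^2+\tau^2),\qquad 1\le j\le M .$$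
   Context: The generalized Caputo derivative is $\partial_{0t}^{\alpha,\lambda(t)}u(x,t)=\frac{1}{\Gamma(1-\alpha)}\int_0^t\frac{\lambda(t-\eta)}{(t-\eta)^\alpha}\frac{\partial u}{\partial\eta}(x,\eta)\,d\eta$. The class $\mathcal{C}^{4,3}_{x,t}$ consists of functions with continuous derivatives $\partial_x^r\partial_t^s u$ on the closed rectangle for $0\le r\le4$, $0\le s\le3$. "Approximation order $\mathcal{O}(h^2+\tau^2)$ on $u$" means that the residual $\psi_i^{j+\sigma}=\Lambda u_i^{(\sigma)}+\varphi_i^{j+\sigma}-\Delta_{0t_{j+\sigma}}^{\alpha,\lambda(t)}u_i$ (with $u_i^j=u(x_i,t_j)$) satisfies $|\psi_i^{j+\sigma}|\le K(h^2+\tau^2)$ for all $1\le i\le N-1$, $0\le j\le M-1$, with $K$ independent of $h,\tau$. Notation: $y_i^j=y(x_i,t_j)$, $t_{j+\sigma}=(j+\sigma)\tau$, $y^{(\sigma)}=\sigma y^{j+1}+(1-\sigma)y^j$, $\varphi_i^{j+\sigma}=f(x_i,t_{j+\sigma})$, $\|y\|_0^2=\sum_{i=1}^{N-1}y_i^2h$. The spatial operator (at time level $j+\sigma$) is $$\Lambda y_i=\frac{a_{i+1}y_{i+1}-(a_{i+1}+a_i)y_i+a_iy_{i-1}}{h^2}-d_iy_i,$$ with $a_i=k(x_{i}-h/2,t_{j+\sigma})$, $d_i=q(x_i,t_{j+\sigma})$. The discrete fractional derivative is $$\Delta_{0t_{j+\sigma}}^{\alpha,\lambda(t)}y_i=\frac{\tau^{1-\alpha}}{\Gamma(2-\alpha)}\sum_{s=0}^{j}c_{j-s}^{(\alpha)}\,\frac{y_i^{s+1}-y_i^s}{\tau}.$$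 Its coefficients are as follows. Write $\lambda_s=\lambda(s\tau)$ for real $s$, $$a_0^{(\alpha)}=\sigma^{1-\alpha},\qquad a_l^{(\alpha)}=(l+\sigma)^{1-\alpha}-(l-1+\sigma)^{1-\alpha}\quad(l\ge1),$$ $$b_l^{(\alpha)}=\tfrac{1}{2-\alpha}\left[(l+\sigma)^{2-\alpha}-(l-1+\sigma)^{2-\alpha}\right]-\tfrac12\left[(l+\sigma)^{1-\alpha}+(l-1+\sigma)^{1-\alpha}\right]\quad(l\ge1).$$ For $j=0$: $c_0^{(\alpha)}=\lambda_{\sigma-1/2}a_0^{(\alpha)}$. For $j\ge1$: $$c_s^{(\alpha)}=\begin{cases}\lambda_{\sigma-1/2}a_0^{(\alpha)}+\lambda_\sigma b_1^{(\alpha)}, & s=0,\\ \lambda_{s+\sigma-1/2}a_s^{(\alpha)}+\lambda_{s+\sigma}b_{s+1}^{(\alpha)}-\lambda_{s+\sigma}b_s^{(\alpha)}, & 1\le s\le j-1,\\ \lambda_{j+\sigma-1/2}a_j^{(\alpha)}-\lambda_{j+\sigma}b_j^{(\alpha)}, & s=j.\end{cases}$$ (The spatial coefficients $a_i,d_i$ are unrelated to $a_l^{(\alpha)},b_l^{(\alpha)}$.) *)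

theory Defs
  imports "HOL-Analysis.Analysis"
begin

section \<open>Derivatives and smoothness on closed intervals\<close>

text \<open>Derivatives on closed intervals are taken within the interval, hence one-sided at its
  endpoints. Functions on a rectangle are curried total functions; only their values on
  the rectangle matter.\<close>

definition deriv_within :: "real set \<Rightarrow> (real \<Rightarrow> real) \<Rightarrow> real \<Rightarrow> real" where
  "deriv_within S g x = vector_derivative g (at x within S)"

primrec Cn_on :: "nat \<Rightarrow> real set \<Rightarrow> (real \<Rightarrow> real) \<Rightarrow> bool" where
  "Cn_on 0 S g \<longleftrightarrow> continuous_on S g"
| "Cn_on (Suc n) S g \<longleftrightarrow> g differentiable_on S \<and> Cn_on n S (deriv_within S g)"

definition dx :: "(real \<Rightarrow> real \<Rightarrow> real) \<Rightarrow> real \<Rightarrow> real \<Rightarrow> real" where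
  "dx u x t = deriv_within {0..1} (\<lambda>\<xi>. u \<xi> t) x"

definition dt :: "real \<Rightarrow> (real \<Rightarrow> real \<Rightarrow> real) \<Rightarrow> real \<Rightarrow> real \<Rightarrow> real" where
  "dt T u x t = deriv_within {0..T} (\<lambda>\<eta>. u x \<eta>) t"

text \<open>The class of functions on \<open>[0,1] \<times> [0,T]\<close> whose derivatives
  \<open>\<partial>\<^sub>x\<^sup>r \<partial>\<^sub>t\<^sup>s u\<close> with \<open>r \<le> m\<close>, \<open>s \<le> n\<close> all exist and are continuous. The existence
  clauses are needed because \<^const>\<open>vector_derivative\<close> is total.\<close>

definition Cxt :: "nat \<Rightarrow> nat \<Rightarrow> real \<Rightarrow> (real \<Rightarrow> real \<Rightarrow> real) \<Rightarrow> bool" where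
  "Cxt m n T u \<longleftrightarrow>
     (\<forall>s<n. \<forall>x\<in>{0..1}. (\<lambda>\<eta>. (dt T ^^ s) u x \<eta>) differentiable_on {0..T}) \<and>
     (\<forall>r<m. \<forall>s\<le>n. \<forall>t\<in>{0..T}.
        (\<lambda>\<xi>. (dx ^^ r) ((dt T ^^ s) u) \<xi> t) differentiable_on {0..1}) \<and>
     (\<forall>r\<le>m. \<forall>s\<le>n.
        continuous_on ({0..1} \<times> {0..T}) (\<lambda>(x, t). (dx ^^ r) ((dt T ^^ s) u) x t))"

section \<open>The differential problem\<close>

definition caputo ::
  "real \<Rightarrow> (real \<Rightarrow> real) \<Rightarrow> real \<Rightarrow> (real \<Rightarrow> real \<Rightarrow> real) \<Rightarrow> real \<Rightarrow> real \<Rightarrow> real" where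
  "caputo \<alpha> lam T u x t =
     1 / Gamma (1 - \<alpha>) *
     integral {0..t} (\<lambda>\<eta>. lam (t - \<eta>) / (t - \<eta>) powr \<alpha> * dt T u x \<eta>)"

definition differential_solution ::
  "real \<Rightarrow> (real \<Rightarrow> real) \<Rightarrow> real \<Rightarrow> (real \<Rightarrow> real \<Rightarrow> real) \<Rightarrow> (real \<Rightarrow> real \<Rightarrow> real) \<Rightarrow>
   (real \<Rightarrow> real \<Rightarrow> real) \<Rightarrow> (real \<Rightarrow> real) \<Rightarrow> (real \<Rightarrow> real \<Rightarrow> real) \<Rightarrow> bool" where
  "differential_solution \<alpha> lam T k q f u0 u \<longleftrightarrow>
     (\<forall>x t. 0 < x \<and> x < 1 \<and> 0 < t \<and> t \<le> T \<longrightarrow>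
        (\<lambda>\<xi>. k \<xi> t * dx u \<xi> t) differentiable (at x) \<and>
        caputo \<alpha> lam T u x t = dx (\<lambda>\<xi> t. k \<xi> t * dx u \<xi> t) x t - q x t * u x t + f x t) \<and>
     (\<forall>t. 0 \<le> t \<and> t \<le> T \<longrightarrow> u 0 t = 0 \<and> u 1 t = 0) \<and>
     (\<forall>x. 0 \<le> x \<and> x \<le> 1 \<longrightarrow> u x 0 = u0 x)"

section \<open>The difference scheme\<close>

text \<open>Grid functions are written \<open>y i j\<close>, with \<open>i\<close> the space index and \<open>j\<close> the time level.\<close>

definition acoef :: "real \<Rightarrow> real \<Rightarrow> nat \<Rightarrow> real" where
  "acoef \<alpha> \<sigma> l =
     (if l = 0 then \<sigma> powr (1 - \<alpha>)
      else (real l + \<sigma>) powr (1 - \<alpha>) - (real l - 1 + \<sigma>) powr (1 - \<alpha>))"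

text \<open>Only used for \<open>l \<ge> 1\<close>.\<close>

definition bcoef :: "real \<Rightarrow> real \<Rightarrow> nat \<Rightarrow> real" where
  "bcoef \<alpha> \<sigma> l =
     1 / (2 - \<alpha>) * ((real l + \<sigma>) powr (2 - \<alpha>) - (real l - 1 + \<sigma>) powr (2 - \<alpha>))
     - 1 / 2 * ((real l + \<sigma>) powr (1 - \<alpha>) + (real l - 1 + \<sigma>) powr (1 - \<alpha>))"

text \<open>The coefficient \<open>c\<^sub>s\<close> belonging to the time level \<open>j + \<sigma>\<close>; only used for \<open>s \<le> j\<close>.\<close>

definition ccoef :: "real \<Rightarrow> real \<Rightarrow> (real \<Rightarrow> real) \<Rightarrow> real \<Rightarrow> nat \<Rightarrow> nat \<Rightarrow> real" where
  "ccoef \<alpha> \<sigma> lam \<tau> j s =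
     (let L = (\<lambda>r. lam (r * \<tau>)) in
      if j = 0 then L (\<sigma> - 1/2) * acoef \<alpha> \<sigma> 0
      else if s = 0 then L (\<sigma> - 1/2) * acoef \<alpha> \<sigma> 0 + L \<sigma> * bcoef \<alpha> \<sigma> 1
      else if s < j then
        L (real s + \<sigma> - 1/2) * acoef \<alpha> \<sigma> s + L (real s + \<sigma>) * bcoef \<alpha> \<sigma> (s + 1)
        - L (real s + \<sigma>) * bcoef \<alpha> \<sigma> s
      else L (real j + \<sigma> - 1/2) * acoef \<alpha> \<sigma> j - L (real j + \<sigma>) * bcoef \<alpha> \<sigma> j)"

definition discrete_caputo ::
  "real \<Rightarrow> real \<Rightarrow> (real \<Rightarrow> real) \<Rightarrow> real \<Rightarrow> (nat \<Rightarrow> nat \<Rightarrow> real) \<Rightarrow> nat \<Rightarrow> nat \<Rightarrow> real" where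
  "discrete_caputo \<alpha> \<sigma> lam \<tau> y i j =
     \<tau> powr (1 - \<alpha>) / Gamma (2 - \<alpha>) *
     (\<Sum>s=0..j. ccoef \<alpha> \<sigma> lam \<tau> j (j - s) * ((y i (s + 1) - y i s) / \<tau>))"

definition sigma_avg :: "real \<Rightarrow> (nat \<Rightarrow> nat \<Rightarrow> real) \<Rightarrow> nat \<Rightarrow> nat \<Rightarrow> real" where
  "sigma_avg \<sigma> y j i = \<sigma> * y i (j + 1) + (1 - \<sigma>) * y i j"

text \<open>The spatial operator at the time \<open>t\<close>, acting on a function \<open>v\<close> of the space index;
  only used for \<open>i \<ge> 1\<close>.\<close>

definition Lambda_op ::
  "(real \<Rightarrow> real \<Rightarrow> real) \<Rightarrow> (real \<Rightarrow> real \<Rightarrow> real) \<Rightarrow> real \<Rightarrow> real \<Rightarrow> (nat \<Rightarrow> real) \<Rightarrow> nat \<Rightarrow> real"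
where
  "Lambda_op k q h t v i =
     (let a = (\<lambda>i::nat. k (real i * h - h / 2) t); d = q (real i * h) t in
      (a (i + 1) * v (i + 1) - (a (i + 1) + a i) * v i + a i * v (i - 1)) / h\<^sup>2 - d * v i)"

definition scheme_solution ::
  "real \<Rightarrow> real \<Rightarrow> (real \<Rightarrow> real) \<Rightarrow> real \<Rightarrow> (real \<Rightarrow> real \<Rightarrow> real) \<Rightarrow> (real \<Rightarrow> real \<Rightarrow> real) \<Rightarrow>
   (real \<Rightarrow> real \<Rightarrow> real) \<Rightarrow> (real \<Rightarrow> real) \<Rightarrow> nat \<Rightarrow> nat \<Rightarrow> (nat \<Rightarrow> nat \<Rightarrow> real) \<Rightarrow> bool" where
  "scheme_solution \<alpha> \<sigma> lam T k q f u0 N M y \<longleftrightarrow>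
     (let h = 1 / real N; \<tau> = T / real M in
      (\<forall>i j. 1 \<le> i \<and> i \<le> N - 1 \<and> j < M \<longrightarrow>
         discrete_caputo \<alpha> \<sigma> lam \<tau> y i j =
           Lambda_op k q h ((real j + \<sigma>) * \<tau>) (sigma_avg \<sigma> y j) i
           + f (real i * h) ((real j + \<sigma>) * \<tau>)) \<and>
      (\<forall>j\<le>M. y 0 j = 0 \<and> y N j = 0) \<and>
      (\<forall>i\<le>N. y i 0 = u0 (real i * h)))"

definition grid_restriction ::
  "real \<Rightarrow> real \<Rightarrow> (real \<Rightarrow> real \<Rightarrow> real) \<Rightarrow> nat \<Rightarrow> nat \<Rightarrow> real" where
  "grid_restriction h \<tau> u i j = u (real i * h) (real j * \<tau>)"

definition residual ::
  "real \<Rightarrow> real \<Rightarrow> (real \<Rightarrow> real) \<Rightarrow> (real \<Rightarrow> real \<Rightarrow> real) \<Rightarrow> (real \<Rightarrow> real \<Rightarrow> real) \<Rightarrow>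
   (real \<Rightarrow> real \<Rightarrow> real) \<Rightarrow> (real \<Rightarrow> real \<Rightarrow> real) \<Rightarrow> real \<Rightarrow> real \<Rightarrow> nat \<Rightarrow> nat \<Rightarrow> real" where
  "residual \<alpha> \<sigma> lam k q f u h \<tau> i j =
     (let U = grid_restriction h \<tau> u in
      Lambda_op k q h ((real j + \<sigma>) * \<tau>) (sigma_avg \<sigma> U j) i
      + f (real i * h) ((real j + \<sigma>) * \<tau>)
      - discrete_caputo \<alpha> \<sigma> lam \<tau> U i j)"

definition approximation_order_2_2 ::
  "real \<Rightarrow> real \<Rightarrow> (real \<Rightarrow> real) \<Rightarrow> real \<Rightarrow> (real \<Rightarrow> real \<Rightarrow> real) \<Rightarrow> (real \<Rightarrow> real \<Rightarrow> real) \<Rightarrow>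
   (real \<Rightarrow> real \<Rightarrow> real) \<Rightarrow> (real \<Rightarrow> real \<Rightarrow> real) \<Rightarrow> bool" where
  "approximation_order_2_2 \<alpha> \<sigma> lam T k q f u \<longleftrightarrow>
     (\<exists>K. \<forall>N\<ge>1. \<forall>M\<ge>1. \<forall>i j. 1 \<le> i \<and> i \<le> N - 1 \<and> j \<le> M - 1 \<longrightarrow>
        \<bar>residual \<alpha> \<sigma> lam k q f u (1 / real N) (T / real M) i j\<bar>
          \<le> K * ((1 / real N)\<^sup>2 + (T / real M)\<^sup>2))"

definition grid_norm :: "nat \<Rightarrow> (nat \<Rightarrow> real) \<Rightarrow> real" where
  "grid_norm N v = sqrt (\<Sum>i=1..N-1. (v i)\<^sup>2 * (1 / real N))"

end

theory Submission
  imports Defs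
begin

text \<open>The error \<open>z = u - y\<close> solves the difference scheme with zero initial and boundary values and the
  residual as right-hand side. Concavity of \<open>x powr (1 - \<alpha>)\<close> and monotonicity of \<open>\<lambda>\<close> give
  \<open>c\<^sub>0 \<ge> c\<^sub>1 \<ge> \<dots> \<ge> c\<^sub>j \<ge> (1 - \<alpha>) \<lambda>(T) (j + \<sigma>) powr (- \<alpha>)\<close> and \<open>(2 \<sigma> - 1) c\<^sub>0 \<ge> \<sigma> c\<^sub>1\<close>. The latter
  yields \<open>z\<^bsup>(\<sigma>)\<^esup> \<Delta>z \<ge> \<Delta>(z\<^sup>2) / 2\<close>, so testing the scheme with \<open>z\<^bsup>(\<sigma>)\<^esup>\<close> and using the discrete
  Poincare inequality bounds \<open>\<Delta>\<parallel>z\<parallel>\<^sup>2\<close> by a multiple of the squared residual; the monotonicity and the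
  lower bound of the \<open>c\<^sub>s\<close> turn this into a bound of \<open>\<parallel>z\<parallel>\<^sup>2\<close> by induction on the time level.\<close>

section \<open>Concavity of the power function\<close>

text \<open>Subtracting the antiderivative of the linear bound from \<open>G\<close> leaves a
  function with nonpositive derivative. This takes the place of integration in the trapezoidal
  estimates below.\<close>

lemma increment_le_linear:
  fixes G g :: "real \<Rightarrow> real"
  assumes der: "\<And>t. x \<le> t \<Longrightarrow> t \<le> x + 1 \<Longrightarrow> (G has_real_derivative g t) (at t)"
    and le: "\<And>t. x \<le> t \<Longrightarrow> t \<le> x + 1 \<Longrightarrow> g t \<le> p + r * (t - x)"
  shows "G (x + 1) - G x \<le> p + r / 2"
proof -
  have "G x - p * (x - x) - r / 2 * (x - x)\<^sup>2
      \<ge> G (x + 1) - p * (x + 1 - x) - r / 2 * (x + 1 - x)\<^sup>2"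
  proof (rule DERIV_nonpos_imp_nonincreasing[where f = "\<lambda>t. G t - p * (t - x) - r / 2 * (t - x)\<^sup>2"])
    fix t assume t: "x \<le> t" "t \<le> x + 1"
    have "((\<lambda>t. G t - p * (t - x) - r / 2 * (t - x)\<^sup>2) has_real_derivative
        g t - p - r * (t - x)) (at t)"
      by (rule derivative_eq_intros der t refl | simp)+
    then show "\<exists>y. ((\<lambda>t. G t - p * (t - x) - r / 2 * (t - x)\<^sup>2) has_real_derivative y) (at t) \<and> y \<le> 0"
      using le[OF t] by force
  qed simp
  then show ?thesis by simp
qed

lemma convex_le_chord:
  fixes g :: "real \<Rightarrow> real"
  assumes "convex_on {0<..} g" "0 < x" "x \<le> t" "t \<le> x + 1"
  shows "g t \<le> g x + (g (x + 1) - g x) * (t - x)"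
proof -
  have "g ((1 - (t - x)) *\<^sub>R x + (t - x) *\<^sub>R (x + 1)) \<le> (1 - (t - x)) * g x + (t - x) * g (x + 1)"
    using assms by (intro convex_onD) auto
  moreover have "(1 - (t - x)) *\<^sub>R x + (t - x) *\<^sub>R (x + 1) = t"
    by (simp add: algebra_simps)
  ultimately show ?thesis by (simp add: algebra_simps)
qed

lemma convex_neg_powr:
  fixes \<alpha> :: real
  assumes "0 < \<alpha>" "\<alpha> < 1"
  shows "convex_on {0<..} (\<lambda>x::real. - (x powr (1 - \<alpha>)))"
proof (rule f''_ge0_imp_convex)
  fix x :: real assume "x \<in> {0<..}"
  then have x: "0 < x" by simp
  show "((\<lambda>x. - (x powr (1 - \<alpha>))) has_real_derivative - ((1 - \<alpha>) * x powr (- \<alpha>))) (at x)"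
    using has_real_derivative_powr[OF x, of "1 - \<alpha>"] by (auto intro: DERIV_minus)
  show "((\<lambda>x. - ((1 - \<alpha>) * x powr (- \<alpha>))) has_real_derivative
      (1 - \<alpha>) * \<alpha> * x powr (- \<alpha> - 1)) (at x)"
    by (rule derivative_eq_intros x refl | simp)+
  show "0 \<le> (1 - \<alpha>) * \<alpha> * x powr (- \<alpha> - 1)"
    using assms by simp
qed simp

lemma convex_powr_minus:
  fixes \<alpha> :: real
  assumes "0 < \<alpha>"
  shows "convex_on {0<..} (\<lambda>x::real. x powr (- \<alpha>))"
proof (rule f''_ge0_imp_convex)
  fix x :: real assume "x \<in> {0<..}"
  then have x: "0 < x" by simp
  show "((\<lambda>x. x powr (- \<alpha>)) has_real_derivative - \<alpha> * x powr (- \<alpha> - 1)) (at x)"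
    using has_real_derivative_powr[OF x, of "- \<alpha>"] by simp
  show "((\<lambda>x. - \<alpha> * x powr (- \<alpha> - 1)) has_real_derivative
      \<alpha> * (\<alpha> + 1) * x powr (- \<alpha> - 2)) (at x)"
    by (rule derivative_eq_intros x refl | simp add: algebra_simps)+
  show "0 \<le> \<alpha> * (\<alpha> + 1) * x powr (- \<alpha> - 2)"
    using assms by simp
qed simp

text \<open>A concave function lies below its tangents; the argument passes to the convex
  negative.\<close>

lemma powr_le_tangent:
  fixes \<alpha> x y :: real
  assumes "0 < \<alpha>" "\<alpha> < 1" "0 < x" "0 < y"
  shows "y powr (1 - \<alpha>) \<le> x powr (1 - \<alpha>) + (1 - \<alpha>) * x powr (- \<alpha>) * (y - x)"
proof -
  have "- (y powr (1 - \<alpha>)) - - (x powr (1 - \<alpha>)) \<ge> - ((1 - \<alpha>) * x powr (- \<alpha>)) * (y - x)"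
  proof (rule convex_on_imp_above_tangent[OF convex_neg_powr[OF assms(1,2)]])
    show "((\<lambda>x. - (x powr (1 - \<alpha>))) has_real_derivative - ((1 - \<alpha>) * x powr (- \<alpha>)))
        (at x within {0<..})"
      using has_real_derivative_powr[OF assms(3), of "1 - \<alpha>"]
      by (auto intro: DERIV_minus has_field_derivative_at_within)
  qed (use assms in \<open>auto simp: interior_open\<close>)
  then show ?thesis by simp
qed

section \<open>The coefficients of the discrete fractional derivative\<close>

text \<open>The error of the trapezoidal rule for \<open>x powr (1 - \<alpha>)\<close> on \<open>[x, x + 1]\<close>.\<close>

definition trap_error :: "real \<Rightarrow> real \<Rightarrow> real" where
  "trap_error \<alpha> x = (x + 1) powr (2 - \<alpha>) / (2 - \<alpha>) - x powr (2 - \<alpha>) / (2 - \<alpha>)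
     - 1 / 2 * (x powr (1 - \<alpha>) + (x + 1) powr (1 - \<alpha>))"

text \<open>The shift by one makes \<open>real l + \<sigma>\<close> the left end of the unit
  interval on which \<open>bcoef\<close> measures exact integral minus trapezoidal value.\<close>

lemma bcoef_Suc: "bcoef \<alpha> \<sigma> (Suc l) = trap_error \<alpha> (real l + \<sigma>)"
proof -
  have *: "real (Suc l) + \<sigma> = real l + \<sigma> + 1" "real (Suc l) - 1 + \<sigma> = real l + \<sigma>"
    by auto
  show ?thesis unfolding bcoef_def trap_error_def *
    by (simp add: diff_divide_distrib)
qed

lemma acoef_Suc:
  "acoef \<alpha> \<sigma> (Suc l) = (real l + \<sigma> + 1) powr (1 - \<alpha>) - (real l + \<sigma>) powr (1 - \<alpha>)"
proof -
  have *: "real (Suc l) + \<sigma> = real l + \<sigma> + 1" "real (Suc l) - 1 + \<sigma> = real l + \<sigma>"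
    by auto
  show ?thesis unfolding acoef_def * by simp
qed

context
  fixes \<alpha> :: real
  assumes \<alpha>: "0 < \<alpha>" "\<alpha> < 1"
begin

lemma has_derivative_powr_integral:
  fixes t :: real
  assumes "0 < t"
  shows "((\<lambda>t. t powr (2 - \<alpha>) / (2 - \<alpha>)) has_real_derivative t powr (1 - \<alpha>)) (at t)"
proof -
  have "((\<lambda>t. t powr (2 - \<alpha>) / (2 - \<alpha>)) has_real_derivative
      (2 - \<alpha>) * t powr (2 - \<alpha> - 1) / (2 - \<alpha>)) (at t)"
    by (intro DERIV_cdivide has_real_derivative_powr assms)
  moreover have "2 - \<alpha> - 1 = 1 - \<alpha>" by simp
  ultimately show ?thesis using \<alpha> by simp
qed

text \<open>The integrand is concave, hence above its chord. Signs are flipped because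
  \<open>increment_le_linear\<close> yields upper bounds.\<close>

lemma trap_error_nonneg:
  assumes "0 < x"
  shows "0 \<le> trap_error \<alpha> x"
proof -
  have "- ((x + 1) powr (2 - \<alpha>) / (2 - \<alpha>)) - - (x powr (2 - \<alpha>) / (2 - \<alpha>))
     \<le> - (x powr (1 - \<alpha>)) + (- ((x + 1) powr (1 - \<alpha>)) - - (x powr (1 - \<alpha>))) / 2"
  proof (rule increment_le_linear)
    fix t assume t: "x \<le> t" "t \<le> x + 1"
    show "((\<lambda>t. - (t powr (2 - \<alpha>) / (2 - \<alpha>))) has_real_derivative - (t powr (1 - \<alpha>))) (at t)"
      using has_derivative_powr_integral[of t] assms t by (auto intro: DERIV_minus)
    show "- (t powr (1 - \<alpha>)) \<le> - (x powr (1 - \<alpha>))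
        + (- ((x + 1) powr (1 - \<alpha>)) - - (x powr (1 - \<alpha>))) * (t - x)"
      using convex_le_chord[OF convex_neg_powr[OF \<alpha>] assms t] .
  qed
  then show ?thesis by (simp add: trap_error_def field_simps)
qed

text \<open>The integrand is bounded by its tangent at the right end \<open>x + 1\<close>, whose
  slope is \<open>?m\<close>, and the tangent is integrated exactly.\<close>

lemma trap_error_le:
  assumes "0 < x"
  shows "trap_error \<alpha> x \<le> 1 / 2 * ((x + 1) powr (1 - \<alpha>) - x powr (1 - \<alpha>))
    - 1 / 2 * ((1 - \<alpha>) * (x + 1) powr (- \<alpha>))"
proof -
  let ?m = "(1 - \<alpha>) * (x + 1) powr (- \<alpha>)"
  have "(x + 1) powr (2 - \<alpha>) / (2 - \<alpha>) - x powr (2 - \<alpha>) / (2 - \<alpha>)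
     \<le> ((x + 1) powr (1 - \<alpha>) - ?m) + ?m / 2"
  proof (rule increment_le_linear)
    fix t assume t: "x \<le> t" "t \<le> x + 1"
    show "((\<lambda>t. t powr (2 - \<alpha>) / (2 - \<alpha>)) has_real_derivative t powr (1 - \<alpha>)) (at t)"
      using has_derivative_powr_integral[of t] assms t by auto
    show "t powr (1 - \<alpha>) \<le> (x + 1) powr (1 - \<alpha>) - ?m + ?m * (t - x)"
      using powr_le_tangent[OF \<alpha>, of "x + 1" t] assms t by (simp add: algebra_simps)
  qed
  then show ?thesis by (simp add: trap_error_def field_simps)
qed

text \<open>The derivative of the trapezoidal error is the trapezoidal error of the derivative, and
  the derivative of \<open>x powr (1 - \<alpha>)\<close> is convex.\<close>

lemma trap_error_antimono:
  assumes "0 < x" "x \<le> y"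
  shows "trap_error \<alpha> y \<le> trap_error \<alpha> x"
proof (rule DERIV_nonpos_imp_nonincreasing[OF assms(2)])
  fix t assume "x \<le> t" "t \<le> y"
  then have t: "0 < t" using assms by simp
  define g where "g s = (1 - \<alpha>) * s powr (- \<alpha>)" for s :: real
  have f: "((\<lambda>s. s powr (1 - \<alpha>)) has_real_derivative g s) (at s)" if "0 < s" for s
    using has_real_derivative_powr[OF that, of "1 - \<alpha>"] by (simp add: g_def)
  have shift: "((\<lambda>s. F (s + 1)) has_real_derivative d) (at t)"
    if "(F has_real_derivative d) (at (t + 1))" for F d
    using that DERIV_shift[of F d t 1] by simp
  have "(trap_error \<alpha> has_real_derivative (t + 1) powr (1 - \<alpha>) - t powr (1 - \<alpha>)
       - 1 / 2 * (g t + g (t + 1))) (at t)"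
    unfolding trap_error_def
    by (intro DERIV_diff DERIV_cmult DERIV_add f t shift[OF f]
        has_derivative_powr_integral shift[OF has_derivative_powr_integral]) (use t in auto)
  moreover have "(t + 1) powr (1 - \<alpha>) - t powr (1 - \<alpha>) \<le> g t + (g (t + 1) - g t) / 2"
  proof (rule increment_le_linear)
    fix s assume s: "t \<le> s" "s \<le> t + 1"
    show "((\<lambda>s. s powr (1 - \<alpha>)) has_real_derivative g s) (at s)"
      using f s t by simp
    have "s powr (- \<alpha>) \<le> t powr (- \<alpha>) + ((t + 1) powr (- \<alpha>) - t powr (- \<alpha>)) * (s - t)"
      by (rule convex_le_chord[OF convex_powr_minus[OF \<alpha>(1)] t s])
    from mult_left_mono[OF this, of "1 - \<alpha>"]
    show "g s \<le> g t + (g (t + 1) - g t) * (s - t)"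
      using \<alpha> by (simp add: g_def algebra_simps)
  qed
  ultimately show "\<exists>d. (trap_error \<alpha> has_real_derivative d) (at t) \<and> d \<le> 0"
    by (force simp: field_simps)
qed

text \<open>The slope \<open>?m\<close> at the common point \<open>x + 1\<close> separates the two
  sides: the left is at most \<open>?m\<close> by the tangent there, the right at least
  \<open>?m\<close> by \<open>trap_error_le\<close> and the same tangent.\<close>

lemma powr_minus_trap_error_antimono:
  assumes "0 < x"
  shows "(x + 2) powr (1 - \<alpha>) - (x + 1) powr (1 - \<alpha>) - trap_error \<alpha> (x + 1)
    \<le> (x + 1) powr (1 - \<alpha>) - x powr (1 - \<alpha>) - trap_error \<alpha> x"
proof -
  let ?m = "(1 - \<alpha>) * (x + 1) powr (- \<alpha>)"
  have "0 \<le> trap_error \<alpha> (x + 1)"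
    using trap_error_nonneg assms by simp
  moreover have "x powr (1 - \<alpha>) \<le> (x + 1) powr (1 - \<alpha>) - ?m"
    "(x + 2) powr (1 - \<alpha>) \<le> (x + 1) powr (1 - \<alpha>) + ?m"
    using powr_le_tangent[OF \<alpha>, of "x + 1" x] powr_le_tangent[OF \<alpha>, of "x + 1" "x + 2"] assms
    by (auto simp: algebra_simps)
  ultimately show ?thesis
    using trap_error_le[OF assms] by argo
qed

section \<open>Estimates for \<open>acoef\<close> and \<open>bcoef\<close> at
  \<open>\<sigma> = 1 - \<alpha> / 2\<close>\<close>

context
  fixes \<sigma> :: real
  assumes \<sigma>: "\<sigma> = 1 - \<alpha> / 2"
begin

text \<open>The last identity is where the choice of \<open>\<sigma>\<close> matters: it turns the
  exponent \<open>1 - \<alpha>\<close> into the factor \<open>2 * \<sigma> - 1\<close> of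
  Alikhanov's inequality.\<close>

lemma sigma_bounds: "1 / 2 < \<sigma>" "\<sigma> < 1" "1 - \<alpha> < \<sigma>" "1 - \<alpha> = 2 * \<sigma> - 1"
  using \<sigma> \<alpha> by auto

lemma acoef_nonneg: "0 \<le> acoef \<alpha> \<sigma> l"
  using sigma_bounds \<alpha> by (cases l) (auto simp: acoef_Suc acoef_def intro!: powr_mono2)

text \<open>The tangent at \<open>\<sigma>\<close> bounds \<open>acoef \<alpha> \<sigma> 1\<close>
  by \<open>(1 - \<alpha>) * \<sigma> powr (- \<alpha>)\<close>; the factor \<open>\<sigma>\<close>
  restores the exponent \<open>1 - \<alpha>\<close>.\<close>

lemma acoef_0_1: "\<sigma> * acoef \<alpha> \<sigma> 1 \<le> (1 - \<alpha>) * acoef \<alpha> \<sigma> 0"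
proof -
  have "acoef \<alpha> \<sigma> 1 \<le> (1 - \<alpha>) * \<sigma> powr (- \<alpha>)"
    using powr_le_tangent[OF \<alpha>, of \<sigma> "\<sigma> + 1"] sigma_bounds(1)
    using acoef_Suc[of \<alpha> \<sigma> 0] by simp
  then have "\<sigma> * acoef \<alpha> \<sigma> 1 \<le> \<sigma> * ((1 - \<alpha>) * \<sigma> powr (- \<alpha>))"
    using sigma_bounds(1) by (intro mult_left_mono) auto
  also have "\<dots> = (1 - \<alpha>) * acoef \<alpha> \<sigma> 0"
    using sigma_bounds powr_mult_base[of \<sigma> "- \<alpha>"] by (simp add: acoef_def)
  finally show ?thesis .
qed

lemma bcoef_nonneg: "0 < l \<Longrightarrow> 0 \<le> bcoef \<alpha> \<sigma> l"
  using sigma_bounds by (cases l) (auto simp: bcoef_Suc intro!: trap_error_nonneg)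

lemma bcoef_antimono: "0 < l \<Longrightarrow> bcoef \<alpha> \<sigma> (Suc l) \<le> bcoef \<alpha> \<sigma> l"
  using sigma_bounds by (cases l) (auto simp: bcoef_Suc intro!: trap_error_antimono)

lemma acoef_bcoef_antimono:
  assumes "0 < l"
  shows "acoef \<alpha> \<sigma> (Suc l) - bcoef \<alpha> \<sigma> (Suc l) \<le> acoef \<alpha> \<sigma> l - bcoef \<alpha> \<sigma> l"
proof -
  obtain n where l: "l = Suc n" using assms by (cases l) auto
  have "real (Suc n) + \<sigma> = real n + \<sigma> + 1" "real n + \<sigma> + 2 = real n + \<sigma> + 1 + 1" by auto
  then show ?thesis
    using powr_minus_trap_error_antimono[of "real n + \<sigma>"] sigma_bounds(1)
    unfolding l acoef_Suc bcoef_Suc by (simp add: add_ac)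
qed

text \<open>By \<open>trap_error_le\<close> the difference is at least the mean of the increment of
  the power and its slope at the right end, and concavity makes the increment at least that
  slope.\<close>

lemma acoef_bcoef_lower:
  assumes "0 < l"
  shows "(1 - \<alpha>) * (real l + \<sigma>) powr (- \<alpha>) \<le> acoef \<alpha> \<sigma> l - bcoef \<alpha> \<sigma> l"
proof -
  obtain n where l: "l = Suc n" using assms by (cases l) auto
  let ?x = "real n + \<sigma>"
  have x: "0 < ?x" "real l + \<sigma> = ?x + 1" using sigma_bounds l by auto
  have "?x powr (1 - \<alpha>) \<le> (?x + 1) powr (1 - \<alpha>) - (1 - \<alpha>) * (?x + 1) powr (- \<alpha>)"
    using powr_le_tangent[OF \<alpha>, of "?x + 1" ?x] x by (simp add: algebra_simps)
  then show ?thesis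
    using trap_error_le[OF x(1)] unfolding x(2) unfolding l acoef_Suc bcoef_Suc by argo
qed

text \<open>Setting \<open>b\<^sub>0 = b\<^bsub>j+1\<^esub> = 0\<close> merges the case distinction in the definition of \<open>c\<^sub>s\<close>.\<close>

definition bcoef0 :: "nat \<Rightarrow> nat \<Rightarrow> real" where
  "bcoef0 j s = (if s = 0 \<or> j < s then 0 else bcoef \<alpha> \<sigma> s)"

lemma ccoef_eq:
  assumes "s \<le> j"
  shows "ccoef \<alpha> \<sigma> lam \<tau> j s = lam ((real s + \<sigma> - 1/2) * \<tau>) * acoef \<alpha> \<sigma> s
    + lam ((real s + \<sigma>) * \<tau>) * (bcoef0 j (Suc s) - bcoef0 j s)"
  using assms by (auto simp: ccoef_def bcoef0_def Let_def algebra_simps)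

section \<open>Bounds and monotonicity of \<open>ccoef\<close>\<close>

context
  fixes lam :: "real \<Rightarrow> real" and T \<tau> :: real and j :: nat
  assumes lam_anti: "\<And>s t. 0 \<le> s \<Longrightarrow> s \<le> t \<Longrightarrow> t \<le> T \<Longrightarrow> lam t \<le> lam s"
    and lam_nonneg: "\<And>t. 0 \<le> t \<Longrightarrow> t \<le> T \<Longrightarrow> 0 \<le> lam t"
    and \<tau>: "0 < \<tau>" "(real j + \<sigma>) * \<tau> \<le> T"
begin

lemma lam_le: "lam (b * \<tau>) \<le> lam (a * \<tau>)" if "0 \<le> a" "a \<le> b" "b \<le> real j + \<sigma>"
proof (rule lam_anti)
  show "b * \<tau> \<le> T"
    using mult_right_mono[OF that(3), of \<tau>] \<tau> by linarith
qed (use that \<tau> in \<open>auto intro: mult_right_mono\<close>)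

lemma lam_ge0: "0 \<le> lam (a * \<tau>)" if "0 \<le> a" "a \<le> real j + \<sigma>"
proof (rule lam_nonneg)
  show "a * \<tau> \<le> T"
    using mult_right_mono[OF that(2), of \<tau>] \<tau> by linarith
qed (use that \<tau> in auto)

text \<open>The value of \<open>lam\<close> is moved back to the earlier time
  \<open>(real s + \<sigma>) * \<tau>\<close>, and the \<open>bcoef0\<close> difference is
  nonpositive, also at the last index. With \<open>ccoef_ge\<close>, neighbouring coefficients are
  thus compared through one common value of \<open>lam\<close>.\<close>

lemma ccoef_Suc_le:
  assumes "s < j"
  shows "ccoef \<alpha> \<sigma> lam \<tau> j (Suc s) \<le> lam ((real s + \<sigma>) * \<tau>) * acoef \<alpha> \<sigma> (Suc s)"
proof -
  have "lam ((real (Suc s) + \<sigma> - 1/2) * \<tau>) * acoef \<alpha> \<sigma> (Suc s)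
      \<le> lam ((real s + \<sigma>) * \<tau>) * acoef \<alpha> \<sigma> (Suc s)"
    using assms sigma_bounds by (intro mult_right_mono lam_le acoef_nonneg) auto
  moreover have "lam ((real (Suc s) + \<sigma>) * \<tau>) * (bcoef0 j (Suc (Suc s)) - bcoef0 j (Suc s)) \<le> 0"
  proof (rule mult_nonneg_nonpos)
    show "0 \<le> lam ((real (Suc s) + \<sigma>) * \<tau>)"
      using assms sigma_bounds by (intro lam_ge0) auto
    show "bcoef0 j (Suc (Suc s)) - bcoef0 j (Suc s) \<le> 0"
      using assms bcoef_nonneg[of "Suc s"] bcoef_antimono[of "Suc s"] by (auto simp: bcoef0_def)
  qed
  ultimately show ?thesis
    using assms by (subst ccoef_eq) auto
qed

lemma ccoef_ge:
  assumes "s \<le> j"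
  shows "lam ((real s + \<sigma>) * \<tau>) * (acoef \<alpha> \<sigma> s + bcoef0 j (Suc s) - bcoef0 j s)
    \<le> ccoef \<alpha> \<sigma> lam \<tau> j s"
proof -
  have "lam ((real s + \<sigma>) * \<tau>) * acoef \<alpha> \<sigma> s \<le> lam ((real s + \<sigma> - 1/2) * \<tau>) * acoef \<alpha> \<sigma> s"
    using assms sigma_bounds by (intro mult_right_mono lam_le acoef_nonneg) auto
  then show ?thesis
    using assms by (subst ccoef_eq) (auto simp: algebra_simps)
qed

text \<open>This is \<open>acoef_0_1\<close> carried over to \<open>ccoef\<close> through the common
  factor \<open>lam (\<sigma> * \<tau>)\<close>; it supplies the hypothesis \<open>last\<close> of
  \<open>weighted_square_difference_le\<close>.\<close>

lemma ccoef_0_1: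
  assumes "0 < j"
  shows "\<sigma> * ccoef \<alpha> \<sigma> lam \<tau> j 1 \<le> (2 * \<sigma> - 1) * ccoef \<alpha> \<sigma> lam \<tau> j 0"
proof -
  have L: "0 \<le> lam (\<sigma> * \<tau>)"
    using sigma_bounds by (intro lam_ge0) auto
  have "\<sigma> * ccoef \<alpha> \<sigma> lam \<tau> j 1 \<le> \<sigma> * (lam (\<sigma> * \<tau>) * acoef \<alpha> \<sigma> 1)"
    using ccoef_Suc_le[OF assms] sigma_bounds by (intro mult_left_mono) auto
  also have "\<dots> = lam (\<sigma> * \<tau>) * (\<sigma> * acoef \<alpha> \<sigma> 1)" by simp
  also have "\<dots> \<le> lam (\<sigma> * \<tau>) * ((2 * \<sigma> - 1) * acoef \<alpha> \<sigma> 0)"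
    using acoef_0_1 L sigma_bounds(4) by (intro mult_left_mono) auto
  also have "\<dots> = (2 * \<sigma> - 1) * (lam (\<sigma> * \<tau>) * acoef \<alpha> \<sigma> 0)" by simp
  also have "\<dots> \<le> (2 * \<sigma> - 1) * (lam (\<sigma> * \<tau>) * (acoef \<alpha> \<sigma> 0 + bcoef0 j (Suc 0)))"
    using L sigma_bounds bcoef_nonneg[of 1] by (intro mult_left_mono) (auto simp: bcoef0_def)
  also have "\<dots> \<le> (2 * \<sigma> - 1) * ccoef \<alpha> \<sigma> lam \<tau> j 0"
    using ccoef_ge[of 0] sigma_bounds by (intro mult_left_mono) (auto simp: bcoef0_def)
  finally show ?thesis .
qed

lemma ccoef_lower:
  assumes "s \<le> j"
  shows "lam ((real s + \<sigma>) * \<tau>) * ((1 - \<alpha>) * (real s + \<sigma>) powr (- \<alpha>)) \<le> ccoef \<alpha> \<sigma> lam \<tau> j s"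
proof -
  have L: "0 \<le> lam ((real s + \<sigma>) * \<tau>)"
    using assms sigma_bounds by (intro lam_ge0) auto
  have B: "0 \<le> bcoef0 j (Suc s)"
    using bcoef_nonneg[of "Suc s"] by (auto simp: bcoef0_def)
  have "(1 - \<alpha>) * (real s + \<sigma>) powr (- \<alpha>) \<le> acoef \<alpha> \<sigma> s + bcoef0 j (Suc s) - bcoef0 j s"
  proof (cases s)
    \<comment> \<open>Nothing is subtracted at index 0, so \<open>1 - \<alpha> < \<sigma>\<close>
      and \<open>\<sigma> * \<sigma> powr (- \<alpha>) = acoef \<alpha> \<sigma> 0\<close>
      suffice.\<close>
    case 0
    have "(1 - \<alpha>) * \<sigma> powr (- \<alpha>) \<le> \<sigma> * \<sigma> powr (- \<alpha>)"
      using sigma_bounds by (intro mult_right_mono) auto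
    also have "\<dots> = acoef \<alpha> \<sigma> 0"
      using sigma_bounds powr_mult_base[of \<sigma> "- \<alpha>"] by (simp add: acoef_def)
    finally show ?thesis using B by (simp add: 0 bcoef0_def)
  next
    case (Suc n)
    then show ?thesis using acoef_bcoef_lower[of s] B assms by (auto simp: bcoef0_def)
  qed
  from mult_left_mono[OF this L] ccoef_ge[OF assms] show ?thesis by linarith
qed

lemma ccoef_nonneg: "s \<le> j \<Longrightarrow> 0 \<le> ccoef \<alpha> \<sigma> lam \<tau> j s"
  using ccoef_lower[of s] lam_ge0[of "real s + \<sigma>"] sigma_bounds \<alpha>
  by (smt (verit) mult_nonneg_nonneg of_nat_0_le_iff of_nat_le_iff powr_ge_zero)

lemma ccoef_antimono:
  assumes "s < j"
  shows "ccoef \<alpha> \<sigma> lam \<tau> j (Suc s) \<le> ccoef \<alpha> \<sigma> lam \<tau> j s"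
proof (cases s)
  \<comment> \<open>\<open>acoef_bcoef_antimono\<close> starts at index 1; here
    \<open>ccoef_0_1\<close> and \<open>2 * \<sigma> - 1 \<le> \<sigma>\<close> are used
    instead.\<close>
  case 0
  have "(2 * \<sigma> - 1) * ccoef \<alpha> \<sigma> lam \<tau> j 0 \<le> \<sigma> * ccoef \<alpha> \<sigma> lam \<tau> j 0"
    using sigma_bounds ccoef_nonneg[of 0] by (intro mult_right_mono) auto
  then have "\<sigma> * ccoef \<alpha> \<sigma> lam \<tau> j 1 \<le> \<sigma> * ccoef \<alpha> \<sigma> lam \<tau> j 0"
    using ccoef_0_1 assms 0 by linarith
  then show ?thesis using sigma_bounds 0 by simp
next
  case (Suc n)
  have "ccoef \<alpha> \<sigma> lam \<tau> j (Suc s) \<le> lam ((real s + \<sigma>) * \<tau>) * acoef \<alpha> \<sigma> (Suc s)"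
    using ccoef_Suc_le[OF assms] .
  also have "\<dots> \<le> lam ((real s + \<sigma>) * \<tau>) * (acoef \<alpha> \<sigma> s + bcoef0 j (Suc s) - bcoef0 j s)"
    using acoef_bcoef_antimono[of s] Suc assms sigma_bounds
    by (intro mult_left_mono lam_ge0) (auto simp: bcoef0_def)
  also have "\<dots> \<le> ccoef \<alpha> \<sigma> lam \<tau> j s"
    using assms by (intro ccoef_ge) auto
  finally show ?thesis .
qed

end

end

end

section \<open>Summation by parts\<close>

text \<open>Abel summation: shifting \<open>P\<close> by \<open>m\<close> leaves the differences
  unchanged but makes the terms nonnegative, so increasing weights help. The lower bound stops at
  \<open>P n\<close>, which lets \<open>discrete_gronwall\<close> apply this while
  \<open>E (Suc j)\<close> is still to be bounded.\<close>

lemma weighted_telescope_ge: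
  fixes g P :: "nat \<Rightarrow> real"
  assumes "\<And>s. s < n \<Longrightarrow> g s \<le> g (Suc s)"
    and "\<And>s. s \<le> n \<Longrightarrow> - m \<le> P s"
  shows "g 0 * (P 0 + m) - g n * (P (Suc n) + m) \<le> (\<Sum>s\<le>n. g s * (P s - P (Suc s)))"
  using assms
proof (induction n)
  case (Suc n)
  have "g n * (P (Suc n) + m) \<le> g (Suc n) * (P (Suc n) + m)"
    using Suc.prems(1)[of n] Suc.prems(2)[of "Suc n"] by (intro mult_right_mono) auto
  moreover have "g 0 * (P 0 + m) - g n * (P (Suc n) + m) \<le> (\<Sum>s\<le>n. g s * (P s - P (Suc s)))"
    using Suc by auto
  ultimately show ?case by (simp add: algebra_simps)
qed (simp add: algebra_simps)

text \<open>Alikhanov's inequality. With \<open>w\<^sub>s = y\<^bsub>j+1\<^esub> - y\<^sub>s\<close> and \<open>v = w\<^sub>j\<close>, the difference of the two sides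
  is the weighted telescoping sum of \<open>w\<^sub>s\<^sup>2 / 2 - (1 - \<sigma>) v w\<^sub>s \<ge> - ((1 - \<sigma>) v)\<^sup>2 / 2\<close>.\<close>

lemma weighted_square_difference_le:
  fixes g y :: "nat \<Rightarrow> real" and \<sigma> :: real
  assumes \<sigma>: "1 / 2 \<le> \<sigma>" "\<sigma> \<le> 1"
    and g0: "0 \<le> g 0"
    and mono: "\<And>s. s < j \<Longrightarrow> g s \<le> g (Suc s)"
    and last: "0 < j \<Longrightarrow> \<sigma> * g (j - 1) \<le> (2 * \<sigma> - 1) * g j"
  shows "1 / 2 * (\<Sum>s\<le>j. g s * ((y (Suc s))\<^sup>2 - (y s)\<^sup>2))
    \<le> (\<sigma> * y (Suc j) + (1 - \<sigma>) * y j) * (\<Sum>s\<le>j. g s * (y (Suc s) - y s))"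
proof -
  define v where "v = y (Suc j) - y j"
  define w where "w s = y (Suc j) - y s" for s
  define P where "P s = (w s)\<^sup>2 / 2 - (1 - \<sigma>) * v * w s" for s
  define m where "m = ((1 - \<sigma>) * v)\<^sup>2 / 2"
  have "(\<sigma> * y (Suc j) + (1 - \<sigma>) * y j) * (y (Suc s) - y s) - 1 / 2 * ((y (Suc s))\<^sup>2 - (y s)\<^sup>2)
      = P s - P (Suc s)" for s
    by (simp add: P_def w_def v_def field_simps power2_eq_square)
  then have "g s * (P s - P (Suc s)) = (\<sigma> * y (Suc j) + (1 - \<sigma>) * y j) * (g s * (y (Suc s) - y s))
      - 1 / 2 * (g s * ((y (Suc s))\<^sup>2 - (y s)\<^sup>2))" for s
    by (metis (no_types, lifting) mult.left_commute right_diff_distrib)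
  then have eq: "(\<sigma> * y (Suc j) + (1 - \<sigma>) * y j) * (\<Sum>s\<le>j. g s * (y (Suc s) - y s))
      - 1 / 2 * (\<Sum>s\<le>j. g s * ((y (Suc s))\<^sup>2 - (y s)\<^sup>2)) = (\<Sum>s\<le>j. g s * (P s - P (Suc s)))"
    by (simp add: sum_distrib_left sum_subtractf)
  have Pj: "P j = (\<sigma> - 1 / 2) * v\<^sup>2" "P (Suc j) = 0"
    by (simp_all add: P_def w_def v_def field_simps power2_eq_square)
  have ge: "- m \<le> P s" for s
    using zero_le_power2[of "w s - (1 - \<sigma>) * v"]
    by (simp add: P_def m_def power2_eq_square field_simps)
  have gpos: "0 \<le> g s" if "s \<le> j" for s
    using that
  proof (induction s)
    case (Suc s)
    then show ?case using mono[of s] by simp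
  qed (use g0 in simp)
  have "0 \<le> (\<Sum>s\<le>j. g s * (P s - P (Suc s)))"
  proof (cases j)
    case 0
    then show ?thesis using Pj g0 \<sigma> by simp
  next
    \<comment> \<open>Telescoping stops at \<open>n = j - 1\<close>. Since
      \<open>P (Suc j) = 0\<close>, the last summand is \<open>g j * P j\<close>, and it pays for
      the boundary term \<open>g n * (P j + m)\<close>.\<close>
    case (Suc n)
    have "g 0 * (P 0 + m) - g n * (P (Suc n) + m) \<le> (\<Sum>s\<le>n. g s * (P s - P (Suc s)))"
      using mono ge Suc by (intro weighted_telescope_ge) auto
    moreover have "0 \<le> g 0 * (P 0 + m)"
      using ge[of 0] g0 by simp
    moreover have "g n * (P (Suc n) + m) \<le> g j * P j"
    proof -
      have "P (Suc n) + m = \<sigma>\<^sup>2 * v\<^sup>2 / 2"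
        using Pj(1) Suc by (simp add: m_def power2_eq_square field_simps)
      then have "g n * (P (Suc n) + m) = g n * (\<sigma>\<^sup>2 * v\<^sup>2 / 2)"
        by simp
      also have "\<dots> \<le> g n * (\<sigma> * v\<^sup>2 / 2)"
      proof -
        have "\<sigma>\<^sup>2 \<le> \<sigma>" using \<sigma> by (simp add: power2_eq_square mult_left_le)
        then show ?thesis using gpos[of n] Suc by (intro mult_left_mono divide_right_mono mult_right_mono) auto
      qed
      also have "\<dots> = (\<sigma> * g n) * (v\<^sup>2 / 2)" by simp
      also have "\<dots> \<le> ((2 * \<sigma> - 1) * g j) * (v\<^sup>2 / 2)"
        using last Suc by (intro mult_right_mono) auto
      also have "\<dots> = g j * P j"
        unfolding Pj(1) by (simp add: field_simps)
      finally show ?thesis .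
    qed
    ultimately show ?thesis using Suc Pj by simp
  qed
  with eq show ?thesis by linarith
qed

section \<open>The energy inequality for the spatial operator\<close>

text \<open>Summation by parts. The right boundary term is kept so that induction on
  \<open>n\<close> works.\<close>

lemma sum_difference_operator_times:
  fixes a v :: "nat \<Rightarrow> real"
  assumes "v 0 = 0"
  shows "(\<Sum>i=1..n. (a (i + 1) * v (i + 1) - (a (i + 1) + a i) * v i + a i * v (i - 1)) * v i)
    = a (n + 1) * (v (n + 1) - v n) * v n - (\<Sum>i=1..n. a i * (v i - v (i - 1))\<^sup>2)"
  using assms by (induction n) (auto simp: algebra_simps power2_eq_square)

text \<open>Each \<open>v i\<close> is a sum of \<open>i\<close> differences, so Cauchy-Schwarz
  costs one factor \<open>N\<close>; summing over the nodes costs the other.\<close>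

lemma discrete_poincare:
  fixes v :: "nat \<Rightarrow> real"
  assumes "v 0 = 0"
  shows "(\<Sum>i=1..N-1. (v i)\<^sup>2) \<le> (real N)\<^sup>2 * (\<Sum>i=1..N. (v i - v (i - 1))\<^sup>2)"
proof -
  let ?S = "\<Sum>i=1..N. (v i - v (i - 1))\<^sup>2"
  have "(v i)\<^sup>2 \<le> real N * ?S" if "i \<in> {1..N-1}" for i
  proof -
    have "v i = (\<Sum>k=1..i. v k - v (k - 1))"
      using assms by (induction i) auto
    then have "(v i)\<^sup>2 \<le> (\<Sum>k=1..i. (v k - v (k - 1))\<^sup>2) * real i"
      using sum_squared_le_sum_of_squares[of "\<lambda>k. v k - v (k - 1)" "{1..i}"] by simp
    also have "\<dots> \<le> ?S * real N"
      using that by (intro mult_mono sum_mono2 sum_nonneg) auto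
    finally show ?thesis by (simp add: mult.commute)
  qed
  then have "(\<Sum>i=1..N-1. (v i)\<^sup>2) \<le> (\<Sum>i=1..N-1. real N * ?S)"
    by (rule sum_mono)
  also have "\<dots> = real (N - 1) * (real N * ?S)"
    by simp
  also have "\<dots> \<le> real N * (real N * ?S)"
    by (intro mult_right_mono mult_nonneg_nonneg sum_nonneg) auto
  finally show ?thesis by (simp add: power2_eq_square mult.assoc)
qed

text \<open>The factor \<open>1 / h\<^sup>2\<close> of the operator cancels the Poincare factor, so
  the constant is independent of the grid.\<close>

lemma Lambda_op_coercive:
  fixes v :: "nat \<Rightarrow> real"
  assumes N: "1 \<le> N" and c: "0 \<le> c"
    and k: "\<And>x. x \<in> {0..1} \<Longrightarrow> c \<le> k x t" and q: "\<And>x. x \<in> {0..1} \<Longrightarrow> 0 \<le> q x t"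
    and v: "v 0 = 0" "v N = 0"
  shows "(\<Sum>i=1..N-1. Lambda_op k q (1 / real N) t v i * v i) \<le> - c * (\<Sum>i=1..N-1. (v i)\<^sup>2)"
proof -
  let ?h = "1 / real N"
  define a where "a i = k (real i * ?h - ?h / 2) t" for i :: nat
  let ?D = "\<lambda>i. (a (i + 1) * v (i + 1) - (a (i + 1) + a i) * v i + a i * v (i - 1)) * v i"
  have a: "c \<le> a i" if "i \<in> {1..N}" for i
    unfolding a_def using that N by (intro k) (auto simp: field_simps)
  have "(\<Sum>i=1..N-1. Lambda_op k q ?h t v i * v i) \<le> (\<Sum>i=1..N-1. (real N)\<^sup>2 * ?D i)"
  proof (rule sum_mono)
    fix i assume i: "i \<in> {1..N-1}"
    have "0 \<le> q (real i * ?h) t * (v i)\<^sup>2"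
      using i N by (intro mult_nonneg_nonneg q) (auto simp: field_simps)
    moreover have "Lambda_op k q ?h t v i * v i
        = (real N)\<^sup>2 * ?D i - q (real i * ?h) t * (v i)\<^sup>2"
      unfolding Lambda_op_def Let_def a_def
      by (simp add: power_one_over algebra_simps power2_eq_square)
    ultimately show "Lambda_op k q ?h t v i * v i \<le> (real N)\<^sup>2 * ?D i" by simp
  qed
  also have "\<dots> = (real N)\<^sup>2 * (\<Sum>i=1..N-1. ?D i)"
    by (simp add: sum_distrib_left)
  \<comment> \<open>As \<open>v N = 0\<close>, the boundary term at \<open>n = N - 1\<close> is
    exactly the summand \<open>i = N\<close> on the right.\<close>
  also have "(\<Sum>i=1..N-1. ?D i) = - (\<Sum>i=1..N. a i * (v i - v (i - 1))\<^sup>2)"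
  proof -
    obtain n where n: "N = Suc n" using N by (cases N) auto
    show ?thesis
      using sum_difference_operator_times[of v a "N - 1"] v
      by (simp add: n power2_eq_square algebra_simps)
  qed
  also have "(real N)\<^sup>2 * - (\<Sum>i=1..N. a i * (v i - v (i - 1))\<^sup>2)
      \<le> (real N)\<^sup>2 * - (\<Sum>i=1..N. c * (v i - v (i - 1))\<^sup>2)"
    using a by (intro mult_left_mono le_imp_neg_le sum_mono mult_right_mono) auto
  also have "\<dots> = - c * ((real N)\<^sup>2 * (\<Sum>i=1..N. (v i - v (i - 1))\<^sup>2))"
    by (simp add: sum_distrib_left[symmetric])
  also have "\<dots> \<le> - c * (\<Sum>i=1..N-1. (v i)\<^sup>2)"
    using discrete_poincare[of v N] v c by (intro mult_left_mono_neg) auto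
  finally show ?thesis .
qed

section \<open>Stability\<close>

lemma discrete_caputo_eq:
  assumes "0 < \<tau>"
  shows "discrete_caputo \<alpha> \<sigma> lam \<tau> y i j = \<tau> powr (- \<alpha>) / Gamma (2 - \<alpha>) *
     (\<Sum>s\<le>j. ccoef \<alpha> \<sigma> lam \<tau> j (j - s) * (y i (Suc s) - y i s))"
proof -
  have "\<tau> powr (1 - \<alpha>) = \<tau> * \<tau> powr (- \<alpha>)"
    using assms powr_mult_base[of \<tau> "- \<alpha>"] by simp
  then show ?thesis
    unfolding discrete_caputo_def using assms
    by (simp add: atLeast0AtMost sum_divide_distrib[symmetric])
qed

context
  fixes \<alpha> \<sigma> T \<tau> :: real and lam :: "real \<Rightarrow> real"
  assumes \<alpha>: "0 < \<alpha>" "\<alpha> < 1" and \<sigma>: "\<sigma> = 1 - \<alpha> / 2"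
    and lam_anti: "\<And>s t. 0 \<le> s \<Longrightarrow> s \<le> t \<Longrightarrow> t \<le> T \<Longrightarrow> lam t \<le> lam s"
    and lam_pos: "\<And>t. 0 \<le> t \<Longrightarrow> t \<le> T \<Longrightarrow> 0 < lam t"
    and \<tau>: "0 < \<tau>"
begin

lemma lam_ge_0: "0 \<le> t \<Longrightarrow> t \<le> T \<Longrightarrow> 0 \<le> lam t"
  by (simp add: lam_pos less_imp_le)


text \<open>The weights are \<open>ccoef\<close> read backwards in time: its decrease becomes the
  increase required by Alikhanov's inequality.\<close>

lemma discrete_caputo_square_le:
  assumes j: "(real j + \<sigma>) * \<tau> \<le> T"
  shows "1 / 2 * discrete_caputo \<alpha> \<sigma> lam \<tau> (\<lambda>i j. (y i j)\<^sup>2) i j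
    \<le> sigma_avg \<sigma> y j i * discrete_caputo \<alpha> \<sigma> lam \<tau> y i j"
proof -
  let ?g = "\<lambda>s. ccoef \<alpha> \<sigma> lam \<tau> j (j - s)"
  have "1 / 2 * (\<Sum>s\<le>j. ?g s * ((y i (Suc s))\<^sup>2 - (y i s)\<^sup>2))
    \<le> (\<sigma> * y i (Suc j) + (1 - \<sigma>) * y i j) * (\<Sum>s\<le>j. ?g s * (y i (Suc s) - y i s))"
  proof (rule weighted_square_difference_le)
    show "1 / 2 \<le> \<sigma>" "\<sigma> \<le> 1" using \<sigma> \<alpha> by auto
    show "0 \<le> ?g 0" using ccoef_nonneg[where lam = lam, OF \<alpha> \<sigma> lam_anti lam_ge_0 \<tau> j] by simp
    show "?g s \<le> ?g (Suc s)" if "s < j" for s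
      using ccoef_antimono[where lam = lam, OF \<alpha> \<sigma> lam_anti lam_ge_0 \<tau> j, of "j - Suc s"] that
      by (simp add: Suc_diff_Suc)
    show "\<sigma> * ?g (j - 1) \<le> (2 * \<sigma> - 1) * ?g j" if "0 < j"
      using ccoef_0_1[where lam = lam, OF \<alpha> \<sigma> lam_anti lam_ge_0 \<tau> j that] that by simp
  qed
  from mult_left_mono[OF this, of "\<tau> powr (- \<alpha>) / Gamma (2 - \<alpha>)"]
  show ?thesis
    using \<alpha> Gamma_real_pos[of "2 - \<alpha>"]
    by (simp add: discrete_caputo_eq[OF \<tau>] sigma_avg_def mult_ac)
qed

text \<open>The constant in \<open>le\<close> is at most \<open>\<tau> powr (- \<alpha>)\<close>
  times the oldest weight \<open>?g 0\<close>, whatever \<open>j\<close> and \<open>\<tau>\<close>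
  are. Hence the source is absorbed by the history and the bound \<open>B\<close> passes to the next
  level without growth.\<close>

lemma discrete_gronwall:
  fixes E :: "nat \<Rightarrow> real"
  assumes E0: "E 0 = 0" and j: "(real j + \<sigma>) * \<tau> \<le> T"
    and le: "discrete_caputo \<alpha> \<sigma> lam \<tau> (\<lambda>_. E) i j
      \<le> lam T * (1 - \<alpha>) * T powr (- \<alpha>) / Gamma (2 - \<alpha>) * B"
    and B: "0 \<le> B" "\<And>s. s \<le> j \<Longrightarrow> E s \<le> B"
  shows "E (Suc j) \<le> B"
proof -
  let ?g = "\<lambda>s. ccoef \<alpha> \<sigma> lam \<tau> j (j - s)"
  let ?G = "Gamma (2 - \<alpha>)"
  have \<sigma>_pos: "0 < \<sigma>" using \<sigma> \<alpha> by simp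
  have G: "0 < ?G" using \<alpha> by (intro Gamma_real_pos) auto
  have t: "0 < (real j + \<sigma>) * \<tau>" using \<tau> \<sigma>_pos by simp
  have T: "0 < T" using t j by linarith
  have "lam T * ((1 - \<alpha>) * (real j + \<sigma>) powr (- \<alpha>))
      \<le> lam ((real j + \<sigma>) * \<tau>) * ((1 - \<alpha>) * (real j + \<sigma>) powr (- \<alpha>))"
    using \<alpha> t j by (intro mult_right_mono lam_anti) auto
  also have "\<dots> \<le> ?g 0"
    using ccoef_lower[where lam = lam, OF \<alpha> \<sigma> lam_anti lam_ge_0 \<tau> j] by simp
  finally have "\<tau> powr (- \<alpha>) * (lam T * ((1 - \<alpha>) * (real j + \<sigma>) powr (- \<alpha>))) \<le> \<tau> powr (- \<alpha>) * ?g 0"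
    by (intro mult_left_mono) auto
  moreover have "lam T * (1 - \<alpha>) * T powr (- \<alpha>) \<le> lam T * (1 - \<alpha>) * ((real j + \<sigma>) * \<tau>) powr (- \<alpha>)"
    using \<alpha> t j T lam_pos[of T] by (intro mult_left_mono powr_mono2') auto
  moreover have "lam T * (1 - \<alpha>) * ((real j + \<sigma>) * \<tau>) powr (- \<alpha>)
      = \<tau> powr (- \<alpha>) * (lam T * ((1 - \<alpha>) * (real j + \<sigma>) powr (- \<alpha>)))"
    using \<tau> \<sigma>_pos by (simp add: powr_mult mult_ac)
  ultimately have g0: "lam T * (1 - \<alpha>) * T powr (- \<alpha>) \<le> \<tau> powr (- \<alpha>) * ?g 0"
    by linarith
  have "\<tau> powr (- \<alpha>) * (\<Sum>s\<le>j. ?g s * (E (Suc s) - E s)) \<le> lam T * (1 - \<alpha>) * T powr (- \<alpha>) * B"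
    using le G by (simp add: discrete_caputo_eq[OF \<tau>] divide_le_cancel)
  also have "\<dots> \<le> \<tau> powr (- \<alpha>) * ?g 0 * B"
    using g0 B(1) by (intro mult_right_mono)
  finally have *: "(\<Sum>s\<le>j. ?g s * (E (Suc s) - E s)) \<le> ?g 0 * B"
    using \<tau> by (simp add: mult.assoc)
  \<comment> \<open>Taken with \<open>P = - E\<close> and \<open>m = B\<close>; the terms
    \<open>?g 0 * B\<close> then cancel against the bound just found.\<close>
  have "?g 0 * (- E 0 + B) - ?g j * (- E (Suc j) + B) \<le> (\<Sum>s\<le>j. ?g s * (- E s - - E (Suc s)))"
  proof (rule weighted_telescope_ge)
    show "?g s \<le> ?g (Suc s)" if "s < j" for s
      using ccoef_antimono[where lam = lam, OF \<alpha> \<sigma> lam_anti lam_ge_0 \<tau> j, of "j - Suc s"] that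
      by (simp add: Suc_diff_Suc)
  qed (use B in auto)
  with * E0 have "0 \<le> ?g j * (B - E (Suc j))"
    by (simp add: algebra_simps)
  moreover have "0 < ?g j"
  proof -
    have "\<sigma> * \<tau> \<le> (real j + \<sigma>) * \<tau>"
      using \<tau> by (intro mult_right_mono) auto
    with j have "\<sigma> * \<tau> \<le> T" by linarith
    then have "0 < lam (\<sigma> * \<tau>) * ((1 - \<alpha>) * \<sigma> powr (- \<alpha>))"
      using \<alpha> \<sigma>_pos \<tau> by (intro mult_pos_pos lam_pos) auto
    also have "\<dots> \<le> ?g j"
      using ccoef_lower[where lam = lam, OF \<alpha> \<sigma> lam_anti lam_ge_0 \<tau> j, of 0] by simp
    finally show ?thesis .
  qed
  ultimately show ?thesis
    by (simp add: zero_le_mult_iff)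
qed

lemma scheme_stability:
  fixes z \<psi> :: "nat \<Rightarrow> nat \<Rightarrow> real" and k q :: "real \<Rightarrow> real \<Rightarrow> real"
  assumes N: "1 \<le> N" and M: "real M * \<tau> = T" and c: "0 < c"
    and k: "\<And>x t. x \<in> {0..1} \<Longrightarrow> t \<in> {0..T} \<Longrightarrow> c \<le> k x t"
    and q: "\<And>x t. x \<in> {0..1} \<Longrightarrow> t \<in> {0..T} \<Longrightarrow> 0 \<le> q x t"
    and bdry: "\<And>j. j \<le> M \<Longrightarrow> z 0 j = 0" "\<And>j. j \<le> M \<Longrightarrow> z N j = 0"
    and init: "\<And>i. i \<le> N \<Longrightarrow> z i 0 = 0"
    and eq: "\<And>i j. i \<in> {1..N-1} \<Longrightarrow> j < M \<Longrightarrow> discrete_caputo \<alpha> \<sigma> lam \<tau> z i j =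
      Lambda_op k q (1 / real N) ((real j + \<sigma>) * \<tau>) (sigma_avg \<sigma> z j) i - \<psi> i j"
    and \<psi>: "\<And>i j. i \<in> {1..N-1} \<Longrightarrow> j < M \<Longrightarrow> \<bar>\<psi> i j\<bar> \<le> R"
    and j: "j \<le> M"
  shows "(\<Sum>i=1..N-1. (z i j)\<^sup>2)
    \<le> real N * (R\<^sup>2 / (2 * c * (lam T * (1 - \<alpha>) * T powr (- \<alpha>) / Gamma (2 - \<alpha>))))"
    (is "_ \<le> real N * (_ / (_ * ?m))")
proof -
  define E where "E j = (\<Sum>i=1..N-1. (z i j)\<^sup>2)" for j
  let ?B = "real N * (R\<^sup>2 / (2 * c * ?m))"
  have E0: "E 0 = 0"
    using init by (auto simp: E_def intro!: sum.neutral)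
  have \<sigma>01: "0 < \<sigma>" "\<sigma> < 1" using \<sigma> \<alpha> by auto
  have T: "0 \<le> T" using M \<tau> by (metis mult_nonneg_nonneg less_imp_le of_nat_0_le_iff)
  show ?thesis
  proof (cases "T = 0")
    \<comment> \<open>Only level 0 exists, and the right-hand side is 0 because
      \<open>0 powr _ = 0\<close> and division by zero gives 0.\<close>
    case True
    then have "j = 0" using M \<tau> j by simp
    then show ?thesis using E0 True by (simp add: E_def)
  next
    case False
    have m: "0 < ?m"
      using \<alpha> T False lam_pos[of T] by (intro divide_pos_pos mult_pos_pos Gamma_real_pos) auto
    have B: "0 \<le> ?B"
      using mult_pos_pos[OF mult_pos_pos[OF zero_less_numeral c] m]
      by (rule mult_nonneg_nonneg[OF of_nat_0_le_iff divide_nonneg_pos[OF zero_le_power2]])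
    have "E j \<le> ?B"
      using j
    proof (induction j rule: less_induct)
      case (less l)
      show ?case
      proof (cases l)
        case 0
        then show ?thesis using E0 B by (simp only:)
      next
        case (Suc j)
        then have jM: "j < M" using less.prems by simp
        let ?t = "(real j + \<sigma>) * \<tau>"
        have "?t \<le> real M * \<tau>"
          using jM \<sigma>01 \<tau> by (intro mult_right_mono) auto
        then have t: "?t \<le> T" "0 \<le> ?t" using M \<tau> \<sigma>01 by auto
        let ?w = "sigma_avg \<sigma> z j"
        \<comment> \<open>The discrete derivative is linear, so it commutes with the sum over the
          nodes; the space index \<open>0\<close> on the left is a dummy.\<close>
        have "1 / 2 * discrete_caputo \<alpha> \<sigma> lam \<tau> (\<lambda>_. E) 0 j
            = (\<Sum>i=1..N-1. 1 / 2 * discrete_caputo \<alpha> \<sigma> lam \<tau> (\<lambda>i j. (z i j)\<^sup>2) i j)"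
        proof -
          have "(\<Sum>s\<le>j. ccoef \<alpha> \<sigma> lam \<tau> j (j - s) * (E (Suc s) - E s))
            = (\<Sum>i=1..N-1. \<Sum>s\<le>j. ccoef \<alpha> \<sigma> lam \<tau> j (j - s) * ((z i (Suc s))\<^sup>2 - (z i s)\<^sup>2))"
            by (subst sum.swap) (simp add: E_def sum_subtractf[symmetric] sum_distrib_left)
          then show ?thesis
            by (simp add: discrete_caputo_eq[OF \<tau>] sum_distrib_left)
        qed
        also have "\<dots> \<le> (\<Sum>i=1..N-1. ?w i * discrete_caputo \<alpha> \<sigma> lam \<tau> z i j)"
          by (intro sum_mono discrete_caputo_square_le t)
        also have "\<dots> = (\<Sum>i=1..N-1. Lambda_op k q (1 / real N) ?t ?w i * ?w i)
            + (\<Sum>i=1..N-1. - ?w i * \<psi> i j)"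
          unfolding sum.distrib[symmetric]
          by (rule sum.cong) (simp_all add: eq[OF _ jM] left_diff_distrib right_diff_distrib mult.commute)
        \<comment> \<open>Young's inequality is weighted so that its square term is exactly what
          coercivity provides; it follows from the square of
          \<open>2 * c * ?w i + \<psi> i j\<close>.\<close>
        also have "\<dots> \<le> - c * (\<Sum>i=1..N-1. (?w i)\<^sup>2)
            + (\<Sum>i=1..N-1. c * (?w i)\<^sup>2 + R\<^sup>2 / (4 * c))"
        proof (intro add_mono sum_mono)
          show "(\<Sum>i=1..N-1. Lambda_op k q (1 / real N) ?t ?w i * ?w i)
              \<le> - c * (\<Sum>i=1..N-1. (?w i)\<^sup>2)"
            using N c k q t bdry jM by (intro Lambda_op_coercive) (auto simp: sigma_avg_def)
          fix i assume i: "i \<in> {1..N-1}"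
          have "(\<psi> i j)\<^sup>2 \<le> R\<^sup>2"
            using \<psi>[OF i jM] by (metis abs_ge_zero power2_abs power_mono)
          then have "(\<psi> i j)\<^sup>2 / (4 * c) \<le> R\<^sup>2 / (4 * c)"
            using c by (simp add: divide_right_mono)
          moreover have "0 \<le> (2 * c * ?w i + \<psi> i j)\<^sup>2 / (4 * c)" using c by simp
          then have "- ?w i * \<psi> i j \<le> c * (?w i)\<^sup>2 + (\<psi> i j)\<^sup>2 / (4 * c)"
            using c by (simp add: field_simps power2_eq_square)
          ultimately show "- ?w i * \<psi> i j \<le> c * (?w i)\<^sup>2 + R\<^sup>2 / (4 * c)" by linarith
        qed
        also have "\<dots> = real (N - 1) * (R\<^sup>2 / (4 * c))"
          by (simp add: sum.distrib sum_distrib_left sum_negf)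
        also have "\<dots> \<le> real N * (R\<^sup>2 / (4 * c))"
          using c by (intro mult_right_mono) auto
        finally have "discrete_caputo \<alpha> \<sigma> lam \<tau> (\<lambda>_. E) 0 j \<le> real N * (R\<^sup>2 / (2 * c))"
          by simp
        also have "\<dots> = ?m * (real N * (R\<^sup>2 / (2 * c * ?m)))"
        proof -
          have "real N * (R\<^sup>2 / (2 * c)) = x * (real N * (R\<^sup>2 / (2 * c * x)))" if "0 < x" for x
            using that c by (simp add: field_simps)
          from this[OF m] show ?thesis .
        qed
        finally show ?thesis
          unfolding Suc
        proof (rule discrete_gronwall[where E = E, OF E0 t(1) _ B])
          show "E s \<le> ?B" if "s \<le> j" for s
            using that less.prems Suc by (intro less.IH) auto
        qed
      qed
    qed
    then show ?thesis by (simp add: E_def)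
  qed
qed

end

section \<open>Convergence\<close>

text \<open>At interior points the derivative within the interval is the ordinary one, and its sign
  there together with continuity suffices.\<close>

lemma antimono_on_interval:
  assumes "Cn_on (Suc n) {0..T} lam" "\<And>t. t \<in> {0..T} \<Longrightarrow> deriv_within {0..T} lam t \<le> 0"
    and "0 \<le> s" "s \<le> t" "t \<le> T"
  shows "lam t \<le> lam s"
proof (rule DERIV_nonpos_imp_decreasing_open[OF assms(4)])
  have diff: "lam differentiable_on {0..T}" using assms(1) by simp
  then show "continuous_on {s..t} lam"
    using assms by (intro continuous_on_subset[OF differentiable_imp_continuous_on]) auto
  fix x assume x: "s < x" "x < t"
  then have "x \<in> {0<..<T}" using assms by auto
  then have at: "at x within {0..T} = at x"
    by (simp add: at_within_Icc_at)
  have "(lam has_vector_derivative deriv_within {0..T} lam x) (at x)"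
    using diff x assms unfolding deriv_within_def at[symmetric]
    by (auto simp: differentiable_on_def vector_derivative_works[symmetric])
  then show "\<exists>d. (lam has_real_derivative d) (at x) \<and> d \<le> 0"
    using assms x by (auto simp: has_real_derivative_iff_has_vector_derivative)
qed

lemma Lambda_op_diff:
  "Lambda_op k q h t (\<lambda>i. v i - w i) i = Lambda_op k q h t v i - Lambda_op k q h t w i"
  by (simp add: Lambda_op_def Let_def diff_divide_distrib add_divide_distrib algebra_simps)

lemma discrete_caputo_diff:
  "discrete_caputo \<alpha> \<sigma> lam \<tau> (\<lambda>i j. v i j - w i j) i j
    = discrete_caputo \<alpha> \<sigma> lam \<tau> v i j - discrete_caputo \<alpha> \<sigma> lam \<tau> w i j"
  unfolding discrete_caputo_def right_diff_distrib[symmetric] sum_subtractf[symmetric]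
  by (simp add: diff_divide_distrib[symmetric] algebra_simps)

lemma sigma_avg_diff:
  "sigma_avg \<sigma> (\<lambda>i j. v i j - w i j) j = (\<lambda>i. sigma_avg \<sigma> v j i - sigma_avg \<sigma> w j i)"
  by (auto simp: sigma_avg_def algebra_simps)

theorem mainTheorem6:
  fixes \<alpha> \<sigma> T c1 c2 :: real
    and lam u0 :: "real \<Rightarrow> real"
    and k q f u :: "real \<Rightarrow> real \<Rightarrow> real"
  assumes "0 < \<alpha>" and "\<alpha> < 1" and "\<sigma> = 1 - \<alpha> / 2" and "0 < T"
    and "Cn_on 2 {0..T} lam"
    and "\<And>t. t \<in> {0..T} \<Longrightarrow> 0 < lam t"
    and "\<And>t. t \<in> {0..T} \<Longrightarrow> deriv_within {0..T} lam t \<le> 0"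
    and "0 < c1"
    and "\<And>x t. x \<in> {0..1} \<Longrightarrow> t \<in> {0..T} \<Longrightarrow> c1 \<le> k x t \<and> k x t \<le> c2"
    and "\<And>x t. x \<in> {0..1} \<Longrightarrow> t \<in> {0..T} \<Longrightarrow> 0 \<le> q x t"
    and "Cxt 4 3 T u"
    and "differential_solution \<alpha> lam T k q f u0 u"
    and "approximation_order_2_2 \<alpha> \<sigma> lam T k q f u"
  shows "\<exists>C. \<forall>N\<ge>1. \<forall>M\<ge>1. \<forall>y. scheme_solution \<alpha> \<sigma> lam T k q f u0 N M y \<longrightarrow>
           (\<forall>j. 1 \<le> j \<and> j \<le> M \<longrightarrow>
              grid_norm N (\<lambda>i. u (real i * (1 / real N)) (real j * (T / real M)) - y i j)
                \<le> C * ((1 / real N)\<^sup>2 + (T / real M)\<^sup>2))"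
proof -
  have anti: "lam t \<le> lam s" if "0 \<le> s" "s \<le> t" "t \<le> T" for s t
    using antimono_on_interval[of 1 T lam] assms(5,7) that by (simp add: numeral_2_eq_2)
  have pos: "0 < lam t" if "0 \<le> t" "t \<le> T" for t
    using assms(6) that by simp
  obtain K where approx: "\<forall>N\<ge>1. \<forall>M\<ge>1. \<forall>i j. 1 \<le> i \<and> i \<le> N - 1 \<and> j \<le> M - 1 \<longrightarrow>
      \<bar>residual \<alpha> \<sigma> lam k q f u (1 / real N) (T / real M) i j\<bar>
        \<le> K * ((1 / real N)\<^sup>2 + (T / real M)\<^sup>2)"
    using assms(13) unfolding approximation_order_2_2_def by blast
  have K: "\<bar>residual \<alpha> \<sigma> lam k q f u (1 / real N) (T / real M) i j\<bar>
        \<le> K * ((1 / real N)\<^sup>2 + (T / real M)\<^sup>2)"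
    if "1 \<le> N" "1 \<le> M" "i \<in> {1..N-1}" "j < M" for N M i j
    using that by (intro approx[rule_format]) auto
  define m where "m = lam T * (1 - \<alpha>) * T powr (- \<alpha>) / Gamma (2 - \<alpha>)"
  \<comment> \<open>The constant is the square root of the stability bound;
    \<open>\<bar>K\<bar>\<close> appears because \<open>K\<close> may have any sign.\<close>
  have "grid_norm N (\<lambda>i. u (real i * (1 / real N)) (real j * (T / real M)) - y i j)
      \<le> \<bar>K\<bar> / sqrt (2 * c1 * m) * ((1 / real N)\<^sup>2 + (T / real M)\<^sup>2)"
    if N: "1 \<le> N" and M: "1 \<le> M" and y: "scheme_solution \<alpha> \<sigma> lam T k q f u0 N M y"
      and j: "j \<le> M" for N M y j
  proof -
    let ?h = "1 / real N" and ?\<tau> = "T / real M"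
    let ?U = "grid_restriction ?h ?\<tau> u"
    let ?R = "K * (?h\<^sup>2 + ?\<tau>\<^sup>2)"
    define z where "z i j = ?U i j - y i j" for i j
    note sol = y[unfolded scheme_solution_def Let_def]
    have u: "u 0 t = 0" "u 1 t = 0" if "0 \<le> t" "t \<le> T" for t
      using assms(12) that by (auto simp: differential_solution_def)
    have u0: "u x 0 = u0 x" if "0 \<le> x" "x \<le> 1" for x
      using assms(12) that by (auto simp: differential_solution_def)
    have "(\<Sum>i=1..N-1. (z i j)\<^sup>2) \<le> real N * (?R\<^sup>2 / (2 * c1 * m))"
      unfolding m_def
    proof (rule scheme_stability[OF assms(1-3) anti pos, where M = M and \<tau> = ?\<tau> and k = k and q = q
          and \<psi> = "residual \<alpha> \<sigma> lam k q f u ?h ?\<tau>"])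
      fix i j assume i: "i \<in> {1..N-1}" and j: "j < M"
      show "\<bar>residual \<alpha> \<sigma> lam k q f u ?h ?\<tau> i j\<bar> \<le> ?R"
        by (rule K[OF N M i j])
      have "discrete_caputo \<alpha> \<sigma> lam ?\<tau> y i j =
           Lambda_op k q ?h ((real j + \<sigma>) * ?\<tau>) (sigma_avg \<sigma> y j) i
           + f (real i * ?h) ((real j + \<sigma>) * ?\<tau>)"
        using sol i j by auto
      then show "discrete_caputo \<alpha> \<sigma> lam ?\<tau> z i j =
          Lambda_op k q ?h ((real j + \<sigma>) * ?\<tau>) (sigma_avg \<sigma> z j) i
          - residual \<alpha> \<sigma> lam k q f u ?h ?\<tau> i j"
        unfolding z_def discrete_caputo_diff sigma_avg_diff Lambda_op_diff residual_def Let_def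
        by simp
    next
      fix j assume j: "j \<le> M"
      have "0 \<le> real j * ?\<tau>" "real j * ?\<tau> \<le> T"
        using j M assms(4) by (auto simp: field_simps)
      then show "z 0 j = 0" "z N j = 0"
        using sol j N u by (auto simp: z_def grid_restriction_def)
    next
      fix i assume i: "i \<le> N"
      then show "z i 0 = 0"
        using sol N u0 by (auto simp: z_def grid_restriction_def)
    qed (use assms N M j in auto)
    \<comment> \<open>The mesh weight \<open>1 / real N\<close> of the norm cancels the factor
      \<open>real N\<close> of the stability bound.\<close>
    then have "(\<Sum>i=1..N-1. (z i j)\<^sup>2 * (1 / real N)) \<le> ?R\<^sup>2 / (2 * c1 * m)"
      using N by (simp add: sum_divide_distrib[symmetric] field_simps)
    then have "grid_norm N (\<lambda>i. z i j) \<le> sqrt (?R\<^sup>2 / (2 * c1 * m))"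
      unfolding grid_norm_def by (rule real_sqrt_le_mono)
    then show ?thesis
      by (simp add: z_def grid_restriction_def real_sqrt_divide abs_mult)
  qed
  then show ?thesis by blast
qed

end
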